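(* Let $\Gamma$ be a finite group acting transitively on $[n]=\{1,\ldots,n\}$, let $T\subseteq\Gamma$ with $e\notin T$, $T=T^{-1}$, and let $G=\mathrm{Cay}(\Gamma,T)$. For $j,i\in[n]$ put $\Gamma_{j,i}=\{\gamma\in\Gamma: j^\gamma=i\}$. Then for each $i\in[n]$ the partition $\Pi_i:\Gamma=\Gamma_{1,i}\cup\Gamma_{2,i}\cup\cdots\cup\Gamma_{n,i}$ (the left coset decomposition of $\Gamma$ with respect to the stabilizer $\Gamma_i$) is an equitable partition of $G$, and its quotient matrix $B_\Pi=(b_{st})_{n\times n}$, $b_{st}=|T\cap\Gamma_{t,s}|$, is symmetric and independent of $i$. Moreover, if $\lambda$ is an eigenvalue of $G$ that is not an eigenvalue of $B_\Pi$, then for each $k\in[n]$, $$\lambda\leq\lambda_2(\mathrm{Cay}(\Gamma_k,T\cap\Gamma_k))+\lambda_2(\mathrm{Cay}(\Gamma,T\setminus(T\cap\Gamma_k))),$$ where $\Gamma_k$ is the stabilizer of $k$.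
   Context: $\Gamma$ acts on the right: $x^{\gamma\delta}=(x^\gamma)^\delta$. $\mathrm{Cay}(\Gamma,T)$ has vertex set $\Gamma$ and edges $\{\gamma,\tau\gamma\}$, $\gamma\in\Gamma$, $\tau\in T$. An equitable partition $V_1\cup\cdots\cup V_q$: every vertex of $V_s$ has the same number $b_{st}$ of neighbours in $V_t$; quotient matrix $(b_{st})$. Eigenvalues of graphs are adjacency eigenvalues; $\lambda_2(H)$ is the second largest adjacency eigenvalue of $H$, counted with multiplicity. *)

theory Defs
  imports
    "HOL-Algebra.Left_Coset"
    "HOL-Library.Countable_Set"
    "HOL-Library.Disjoint_Sets"
    "Jordan_Normal_Form.Char_Poly"
begin

text \<open>Undirected graphs are pairs of a vertex set and a set of edges, an edge being the set of
  its end points.\<close>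

type_synonym 'a ugraph = "'a set \<times> 'a set set"

abbreviation verts :: "'a ugraph \<Rightarrow> 'a set" where
  "verts G \<equiv> fst G"

abbreviation edges :: "'a ugraph \<Rightarrow> 'a set set" where
  "edges G \<equiv> snd G"

definition neighbours :: "'a ugraph \<Rightarrow> 'a \<Rightarrow> 'a set" where
  "neighbours G v = {u \<in> verts G. {v, u} \<in> edges G}"

text \<open>For finite \<open>V\<close>, \<open>from_nat_into V\<close> is a bijection from \<open>{..<card V}\<close> to \<open>V\<close>. The choice of
  this ordering changes the matrix only by a simultaneous permutation of rows and columns, so
  its eigenvalues and characteristic polynomial depend on the graph alone.\<close>

definition adjacency_matrix :: "'a ugraph \<Rightarrow> real mat" where
  "adjacency_matrix G =
     mat (card (verts G)) (card (verts G))
       (\<lambda>(i, j). if {from_nat_into (verts G) i, from_nat_into (verts G) j} \<in> edges G then 1 else 0)"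

definition graph_eigenvalue :: "'a ugraph \<Rightarrow> real \<Rightarrow> bool" where
  "graph_eigenvalue G \<mu> \<longleftrightarrow> eigenvalue (adjacency_matrix G) \<mu>"

text \<open>The eigenvalues of a graph with their multiplicities, in descending order. Adjacency matrices
  are real symmetric, so there are as many real eigenvalues as there are vertices. Lists are indexed
  from 0, so the second largest eigenvalue has index 1; \<open>lambda2\<close> is meaningful only for
  graphs with at least two vertices.\<close>

definition graph_spectrum :: "'a ugraph \<Rightarrow> real list" where
  "graph_spectrum G = rev (sorted_list_of_multiset (proots (char_poly (adjacency_matrix G))))"

definition lambda2 :: "'a ugraph \<Rightarrow> real" where
  "lambda2 G = graph_spectrum G ! 1"

definition equitable_partition :: "'a ugraph \<Rightarrow> nat \<Rightarrow> (nat \<Rightarrow> 'a set) \<Rightarrow> bool" where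
  "equitable_partition G q P \<longleftrightarrow>
     partition_on (verts G) (P ` {1..q}) \<and> disjoint_family_on P {1..q} \<and>
     (\<exists>b. \<forall>s \<in> {1..q}. \<forall>t \<in> {1..q}. \<forall>v \<in> P s. card (neighbours G v \<inter> P t) = b s t)"

text \<open>Parts are numbered from 1, but rows and columns of a matrix from 0. The description below
  determines the entries whenever the partition is equitable, since its parts are nonempty.\<close>

definition quotient_matrix :: "'a ugraph \<Rightarrow> nat \<Rightarrow> (nat \<Rightarrow> 'a set) \<Rightarrow> real mat" where
  "quotient_matrix G q P =
     mat q q (\<lambda>(s, t). real (THE b. \<forall>v \<in> P (Suc s). card (neighbours G v \<inter> P (Suc t)) = b))"

definition cay :: "('g, 'm) monoid_scheme \<Rightarrow> 'g set \<Rightarrow> 'g ugraph" where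
  "cay \<Gamma> T = (carrier \<Gamma>, {{\<gamma>, \<tau> \<otimes>\<^bsub>\<Gamma>\<^esub> \<gamma>} |\<gamma> \<tau>. \<gamma> \<in> carrier \<Gamma> \<and> \<tau> \<in> T})"

text \<open>The library's group actions are left actions; here groups act on the right, and
  \<open>act x \<gamma>\<close> stands for \<open>x\<^sup>\<gamma>\<close>.\<close>

locale right_group_action = group \<Gamma>
  for \<Gamma> :: "('g, 'm) monoid_scheme" (structure) and X :: "'x set" and act :: "'x \<Rightarrow> 'g \<Rightarrow> 'x" +
  assumes act_closed: "\<lbrakk>x \<in> X; \<gamma> \<in> carrier \<Gamma>\<rbrakk> \<Longrightarrow> act x \<gamma> \<in> X"
    and act_one: "x \<in> X \<Longrightarrow> act x \<one> = x"
    and act_mult: "\<lbrakk>x \<in> X; \<gamma> \<in> carrier \<Gamma>; \<delta> \<in> carrier \<Gamma>\<rbrakk> \<Longrightarrow> act x (\<gamma> \<otimes> \<delta>) = act (act x \<gamma>) \<delta>"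

locale transitive_right_group_action = right_group_action +
  assumes transitive: "\<lbrakk>x \<in> X; y \<in> X\<rbrakk> \<Longrightarrow> \<exists>\<gamma> \<in> carrier \<Gamma>. act x \<gamma> = y"

definition transporter :: "('g, 'm) monoid_scheme \<Rightarrow> ('x \<Rightarrow> 'g \<Rightarrow> 'x) \<Rightarrow> 'x \<Rightarrow> 'x \<Rightarrow> 'g set" where
  "transporter \<Gamma> act j i = {\<gamma> \<in> carrier \<Gamma>. act j \<gamma> = i}"

definition point_stabilizer :: "('g, 'm) monoid_scheme \<Rightarrow> ('x \<Rightarrow> 'g \<Rightarrow> 'x) \<Rightarrow> 'x \<Rightarrow> 'g set" where
  "point_stabilizer \<Gamma> act k = {\<gamma> \<in> carrier \<Gamma>. act k \<gamma> = k}"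

text \<open>The matrix \<open>B\<^sub>\<Pi>\<close> of a group acting on \<open>{1..n}\<close>, again with indices shifted by one: the entry
  \<open>b\<^sub>s\<^sub>t\<close> counts the elements of \<open>T\<close> that move \<open>t\<close> to \<open>s\<close>.\<close>

definition B_mat ::
  "('g, 'm) monoid_scheme \<Rightarrow> (nat \<Rightarrow> 'g \<Rightarrow> nat) \<Rightarrow> 'g set \<Rightarrow> nat \<Rightarrow> real mat" where
  "B_mat \<Gamma> act T n = mat n n (\<lambda>(s, t). real (card (T \<inter> transporter \<Gamma> act (Suc t) (Suc s))))"

end

theory Submission
  imports Defs "HOL-Analysis.Function_Topology"
begin

text \<open>Summing a vector \<open>f\<close> over the cells of the partition for \<open>i\<close> turns the adjacency operator of the Cayley
  graph into the quotient matrix. So an eigenvector \<open>f\<close> for an eigenvalue that the quotient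
  matrix does not have sums to zero over every set of elements moving \<open>j\<close> to \<open>i\<close>.

  For fixed \<open>k\<close> these sets are the right cosets of the stabilizer of \<open>k\<close>. Split the edges by whether
  the connecting element fixes \<open>k\<close>. The first part is a disjoint union of copies of the Cayley graph
  of the stabilizer, one on each coset, and \<open>f\<close> is orthogonal to the constants on each of them; it is
  also orthogonal to the constants on the whole group. In a regular graph the quadratic form of the
  adjacency matrix at a vector orthogonal to the constants is at most the second largest eigenvalue
  times the squared norm, so adding the two bounds gives the inequality. If the stabilizer is
  trivial, where its second eigenvalue is a junk value, no such \<open>f\<close> exists.

  The bound for regular graphs needs no spectral theorem: a maximizer of the quadratic form on the
  unit sphere orthogonal to the constants is an eigenvector, and together with the constant vector
  it gives two roots of the characteristic polynomial, counted with multiplicity.\<close>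

section \<open>Eigenvectors and the second largest root\<close>

text \<open>The nonzero 2 by 2 minor says that \<open>u\<close> and \<open>v\<close> are linearly
  independent. Since \<open>a\<close> and \<open>b\<close> may coincide, double roots are covered
  too; for a regular graph this occurs when the second eigenvalue equals the degree.\<close>

lemma linear_factors_dvd_char_poly:
  fixes A :: "'a::field mat"
  assumes A: "A \<in> carrier_mat n n"
    and u: "u \<in> carrier_vec n" "A *\<^sub>v u = a \<cdot>\<^sub>v u"
    and v: "v \<in> carrier_vec n" "A *\<^sub>v v = b \<cdot>\<^sub>v v"
    and ij: "i < n" "j < n" "u $ i * v $ j \<noteq> u $ j * v $ i"
  shows "[:-a, 1:] * [:-b, 1:] dvd char_poly A"
proof -
  \<comment> \<open>\<open>P\<close> is the identity with rows \<open>i\<close>, \<open>j\<close> replaced by \<open>u\<close>, \<open>v\<close>. Multiplying \<open>P\<close> with the transposed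
    characteristic matrix makes row \<open>i\<close> divisible by \<open>X - a\<close> and row \<open>j\<close> by \<open>X - b\<close>.\<close>
  define P where "P = mat n n (\<lambda>(k, l). if k = i then u $ l else if k = j then v $ l
    else if k = l then 1 else 0)"
  define PC where "PC = map_mat (\<lambda>x. [:x:]) P * char_poly_matrix (transpose_mat A)"
  define M where "M = mat n n (\<lambda>(k, l). if k = i then [:u $ l:] else if k = j then [:v $ l:]
    else PC $$ (k, l))"
  have P: "P \<in> carrier_mat n n" and M: "M \<in> carrier_mat n n"
    by (simp_all add: P_def M_def)
  have C: "char_poly_matrix (transpose_mat A) \<in> carrier_mat n n"
    using A by simp
  have PC: "PC \<in> carrier_mat n n"
    using P C by (simp add: PC_def)
  have neq: "i \<noteq> j"
    using ij(3) by auto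
  interpret cst: comm_ring_hom "\<lambda>x::'a. [:x:]"
    by unfold_locales (auto simp: one_pCons)
  have row: "(\<Sum>k<n. [:w $ k:] * char_poly_matrix (transpose_mat A) $$ (k, l)) = [:-c, 1:] * [:w $ l:]"
    if w: "w \<in> carrier_vec n" "A *\<^sub>v w = c \<cdot>\<^sub>v w" and l: "l < n" for w c l
  proof -
    have "(\<Sum>k<n. [:w $ k:] * char_poly_matrix (transpose_mat A) $$ (k, l))
        = (\<Sum>k<n. (if k = l then [:0, 1:] * [:w $ k:] else 0) - [:A $$ (l, k) * w $ k:])"
      by (rule sum.cong) (use A l in \<open>auto simp: char_poly_matrix_def algebra_simps\<close>)
    also have "\<dots> = [:0, 1:] * [:w $ l:] - [:\<Sum>k<n. A $$ (l, k) * w $ k:]"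
      using l by (simp add: sum_subtractf cst.hom_sum)
    also have "(\<Sum>k<n. A $$ (l, k) * w $ k) = (A *\<^sub>v w) $ l"
      using A w(1) l by (auto simp: scalar_prod_def atLeast0LessThan intro!: sum.cong)
    also have "\<dots> = c * w $ l"
      using w l by simp
    finally show ?thesis
      by simp
  qed
  have "PC = multrow i [:-a, 1:] (multrow j [:-b, 1:] M)"
  proof (rule eq_matI)
    fix k l assume "k < dim_row (multrow i [:-a, 1:] (multrow j [:-b, 1:] M))"
      "l < dim_col (multrow i [:-a, 1:] (multrow j [:-b, 1:] M))"
    then have k: "k < n" and l: "l < n"
      using M by auto
    have "PC $$ (k, l) = (\<Sum>m<n. [:P $$ (k, m):] * char_poly_matrix (transpose_mat A) $$ (m, l))"
      using P C k l by (auto simp: PC_def scalar_prod_def atLeast0LessThan intro!: sum.cong)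
    then have "k = i \<Longrightarrow> PC $$ (k, l) = [:-a, 1:] * [:u $ l:]"
      "k = j \<Longrightarrow> PC $$ (k, l) = [:-b, 1:] * [:v $ l:]"
      using row[OF u l] row[OF v l] k l neq by (simp_all add: P_def)
    then show "PC $$ (k, l) = multrow i [:-a, 1:] (multrow j [:-b, 1:] M) $$ (k, l)"
      using k l neq by (auto simp: M_def)
  qed (use M PC in auto)
  moreover have "det (multrow i [:-a, 1:] (multrow j [:-b, 1:] M)) = [:-a, 1:] * ([:-b, 1:] * det M)"
    using det_multrow[OF ij(1), of "multrow j [:-b, 1:] M" "[:-a, 1:]"] det_multrow[OF ij(2) M] M
    by simp
  moreover have "det PC = [:det P:] * char_poly A"
    using P C A by (simp add: PC_def det_mult[of _ n] char_poly_def[symmetric])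
  ultimately have eq: "Polynomial.smult (det P) (char_poly A) = [:-a, 1:] * [:-b, 1:] * det M"
    by (simp only: mult.assoc) simp
  \<comment> \<open>A kernel vector of \<open>P\<close> vanishes off \<open>i\<close> and
    \<open>j\<close>, and its two remaining entries solve a homogeneous system whose determinant is
    the minor assumed to be nonzero.\<close>
  have "det P \<noteq> 0"
  proof
    assume "det P = 0"
    then obtain w where w: "w \<in> carrier_vec n" "w \<noteq> 0\<^sub>v n" "P *\<^sub>v w = 0\<^sub>v n"
      using det_0_iff_vec_prod_zero_field[OF P] by auto
    have Pw: "(\<Sum>l<n. P $$ (k, l) * w $ l) = 0" if "k < n" for k
    proof -
      have "(\<Sum>l<n. P $$ (k, l) * w $ l) = (P *\<^sub>v w) $ k"
        using that P w(1) by (auto simp: scalar_prod_def atLeast0LessThan intro!: sum.cong)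
      then show ?thesis
        using w that by simp
    qed
    have z: "w $ k = 0" if "k < n" "k \<noteq> i" "k \<noteq> j" for k
    proof -
      have "(\<Sum>l<n. P $$ (k, l) * w $ l) = (\<Sum>l<n. if k = l then w $ l else 0)"
        by (rule sum.cong) (use that in \<open>auto simp: P_def\<close>)
      then show ?thesis
        using Pw[OF that(1)] that(1) by simp
    qed
    have S: "x $ i * w $ i + x $ j * w $ j = 0"
      if "(\<Sum>l<n. x $ l * w $ l) = 0" for x
    proof -
      have "(\<Sum>l<n. x $ l * w $ l) = (\<Sum>l\<in>{i, j}. x $ l * w $ l)"
        by (rule sum.mono_neutral_right) (use z ij in auto)
      then show ?thesis
        using that neq by simp
    qed
    have 1: "u $ i * w $ i + u $ j * w $ j = 0"
      using Pw[OF ij(1)] ij by (intro S) (simp add: P_def)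
    have 2: "v $ i * w $ i + v $ j * w $ j = 0"
      using Pw[OF ij(2)] ij neq by (intro S) (simp add: P_def)
    have "(u $ i * v $ j - u $ j * v $ i) * w $ i
        = v $ j * (u $ i * w $ i + u $ j * w $ j) - u $ j * (v $ i * w $ i + v $ j * w $ j)"
      "(u $ i * v $ j - u $ j * v $ i) * w $ j
        = u $ i * (v $ i * w $ i + v $ j * w $ j) - v $ i * (u $ i * w $ i + u $ j * w $ j)"
      by (simp_all add: algebra_simps)
    then have "(u $ i * v $ j - u $ j * v $ i) * w $ i = 0"
      "(u $ i * v $ j - u $ j * v $ i) * w $ j = 0"
      by (simp_all only: 1 2) simp_all
    then have "w $ i = 0" "w $ j = 0"
      using ij(3) by auto
    then have "w $ k = 0" if "k < n" for k
      using z[OF that] by blast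
    then have "w = 0\<^sub>v n"
      using w(1) by (intro eq_vecI) simp_all
    then show False
      using w by simp
  qed
  then show ?thesis
    using eq dvd_smult_cancel[of _ "det P" "char_poly A"] dvd_triv_left by metis
qed

text \<open>Only the head of the descending list precedes index 1. Removing that one element leaves
  \<open>a\<close> or \<open>b\<close>, both at least \<open>b\<close>, and index 1 holds the
  largest element of the rest.\<close>

lemma rev_sorted_list_of_multiset_nth_1_ge:
  fixes M :: "'a::linorder multiset"
  assumes "{#a, b#} \<subseteq># M" "b \<le> a"
  shows "b \<le> rev (sorted_list_of_multiset M) ! 1"
proof -
  define xs where "xs = rev (sorted_list_of_multiset M)"
  have xs: "mset xs = M" "sorted (rev xs)"
    by (simp_all add: xs_def)
  obtain N where "M = {#a, b#} + N"
    using assms by (metis subset_mset.add_diff_inverse)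
  then have "size M \<ge> 2"
    by simp
  then have "length xs \<ge> 2"
    using xs by auto
  then obtain x y zs where xyz: "xs = x # y # zs"
    by (cases xs; cases "tl xs") auto
  have "y \<ge> z" if "z \<in># mset (y # zs)" for z
    using xs(2) that by (auto simp: xyz sorted_append)
  moreover have "\<exists>z \<in># mset (y # zs). b \<le> z"
  proof -
    have sub: "{#a, b#} \<subseteq># add_mset x (mset (y # zs))"
      using assms xs by (simp add: xyz)
    show ?thesis
    proof (cases "x = b")
      case True
      with sub have "{#a#} \<subseteq># mset (y # zs)"
        by (metis add_mset_commute mset_subset_eq_add_mset_cancel)
      then show ?thesis
        using assms by auto
    next
      case False
      have "b \<in># add_mset x (mset (y # zs))"
        using mset_subset_eqD[OF sub, of b] by simp
      with False show ?thesis
        by auto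
    qed
  qed
  ultimately have "b \<le> y"
    using order_trans by blast
  then show ?thesis
    by (simp add: xs_def[symmetric] xyz)
qed

section \<open>Quadratic forms on the unit sphere orthogonal to the constants\<close>

lemma quadratic_form_attains_max_on_sphere:
  fixes a :: "'v \<Rightarrow> 'v \<Rightarrow> real" and x :: "'v \<Rightarrow> real"
  assumes V: "finite V" and x: "(\<Sum>v\<in>V. x v) = 0" "(\<Sum>v\<in>V. (x v)\<^sup>2) \<noteq> 0"
  obtains f where "(\<Sum>v\<in>V. f v) = 0" "(\<Sum>v\<in>V. (f v)\<^sup>2) = 1"
    "\<And>g. \<lbrakk>(\<Sum>v\<in>V. g v) = 0; (\<Sum>v\<in>V. (g v)\<^sup>2) = 1\<rbrakk> \<Longrightarrow>
       (\<Sum>v\<in>V. \<Sum>u\<in>V. a v u * g v * g u) \<le> (\<Sum>v\<in>V. \<Sum>u\<in>V. a v u * f v * f u)"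
proof -
  define Q where "Q f = (\<Sum>v\<in>V. \<Sum>u\<in>V. a v u * f v * f u)" for f
  \<comment> \<open>Functions live on the whole type, which may be infinite. Pinning the values off
    \<open>V\<close> to 0 makes the domain a product of compact sets, compact by Tychonoff, and
    loses nothing because the sums only see \<open>V\<close>.\<close>
  define K where "K = (\<Pi>\<^sub>E v\<in>UNIV. if v \<in> V then {-1..1::real} else {0})"
  define S where "S = K \<inter> ({f. (\<Sum>v\<in>V. f v) = 0} \<inter> {f. (\<Sum>v\<in>V. (f v)\<^sup>2) = 1})"
  have "compactin (product_topology (\<lambda>_. euclidean) UNIV) K"
    unfolding K_def compactin_PiE by auto
  then have "compact K"
    by (simp add: euclidean_product_topology)
  moreover have "closed ({f. (\<Sum>v\<in>V. f v) = 0} \<inter> {f::'v \<Rightarrow> real. (\<Sum>v\<in>V. (f v)\<^sup>2) = 1})"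
    by (intro closed_Int closed_Collect_eq continuous_intros continuous_on_product_coordinates)
  ultimately have "compact S"
    unfolding S_def by (rule compact_Int_closed)
  have normal: "(\<lambda>v. if v \<in> V then g v else 0) \<in> S"
    if "(\<Sum>v\<in>V. g v) = 0" "(\<Sum>v\<in>V. (g v)\<^sup>2) = 1" for g
  proof -
    have "\<bar>g v\<bar> \<le> 1" if "v \<in> V" for v
    proof -
      have "(g v)\<^sup>2 \<le> (\<Sum>v\<in>V. (g v)\<^sup>2)"
        using V that by (intro member_le_sum) auto
      then show ?thesis
        using \<open>(\<Sum>v\<in>V. (g v)\<^sup>2) = 1\<close> by (simp add: abs_square_le_1)
    qed
    then show ?thesis
      using that by (auto simp: S_def K_def abs_le_iff minus_le_iff)
  qed
  \<comment> \<open>Rescaling \<open>x\<close> to norm 1 shows that \<open>S\<close> is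
    nonempty.\<close>
  define c where "c = sqrt (\<Sum>v\<in>V. (x v)\<^sup>2)"
  have "c\<^sup>2 = (\<Sum>v\<in>V. (x v)\<^sup>2)"
    by (simp add: c_def sum_nonneg)
  then have "(\<lambda>v. if v \<in> V then x v / c else 0) \<in> S"
    using x by (intro normal) (simp_all add: sum_divide_distrib[symmetric] power_divide)
  then have "S \<noteq> {}"
    by auto
  moreover have "continuous_on S Q"
    unfolding Q_def
    by (intro continuous_intros continuous_on_subset[OF continuous_on_product_coordinates]) auto
  ultimately obtain f where f: "f \<in> S" "\<And>g. g \<in> S \<Longrightarrow> Q g \<le> Q f"
    using continuous_attains_sup[OF \<open>compact S\<close>, of Q] by blast
  show thesis
  proof (rule that)
    fix g :: "'v \<Rightarrow> real" assume g: "(\<Sum>v\<in>V. g v) = 0" "(\<Sum>v\<in>V. (g v)\<^sup>2) = 1"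
    have "Q g = Q (\<lambda>v. if v \<in> V then g v else 0)"
      by (simp add: Q_def)
    also have "\<dots> \<le> Q f"
      by (intro f normal g)
    finally show "(\<Sum>v\<in>V. \<Sum>u\<in>V. a v u * g v * g u) \<le> (\<Sum>v\<in>V. \<Sum>u\<in>V. a v u * f v * f u)"
      by (simp add: Q_def)
  qed (use f in \<open>auto simp: S_def\<close>)
qed

text \<open>Regularity makes the constants an eigenvector for \<open>d\<close>, so by symmetry their
  orthogonal complement is invariant, and a maximizer there is an eigenvector on the full space. The
  bound \<open>\<mu> \<le> d\<close>, due to the nonnegative entries, later ranks the root
  \<open>\<mu>\<close> below the root \<open>d\<close>.\<close>

lemma max_eigenpair_orthogonal_to_constants:
  fixes a :: "'v \<Rightarrow> 'v \<Rightarrow> real" and d :: real and x :: "'v \<Rightarrow> real"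
  assumes V: "finite V" and sym: "\<And>v u. a v u = a u v" and nonneg: "\<And>v u. 0 \<le> a v u"
    and reg: "\<And>v. v \<in> V \<Longrightarrow> (\<Sum>u\<in>V. a v u) = d"
    and x: "(\<Sum>v\<in>V. x v) = 0" "(\<Sum>v\<in>V. (x v)\<^sup>2) \<noteq> 0"
  obtains \<mu> g where "\<mu> \<le> d" "(\<Sum>v\<in>V. g v) = 0" "(\<Sum>v\<in>V. (g v)\<^sup>2) = 1"
    "\<And>v. v \<in> V \<Longrightarrow> (\<Sum>u\<in>V. a v u * g u) = \<mu> * g v"
    "(\<Sum>v\<in>V. \<Sum>u\<in>V. a v u * x v * x u) \<le> \<mu> * (\<Sum>v\<in>V. (x v)\<^sup>2)"
proof -
  define Q where "Q h = (\<Sum>v\<in>V. \<Sum>u\<in>V. a v u * h v * h u)" for h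
  define N where "N h = (\<Sum>v\<in>V. (h v)\<^sup>2)" for h :: "'v \<Rightarrow> real"
  obtain g where g: "(\<Sum>v\<in>V. g v) = 0" "N g = 1"
    and max: "\<And>h. \<lbrakk>(\<Sum>v\<in>V. h v) = 0; N h = 1\<rbrakk> \<Longrightarrow> Q h \<le> Q g"
  proof (rule quadratic_form_attains_max_on_sphere[OF V x, of a], goal_cases)
    case (1 f)
    then show ?case
      by (intro 1(1)[of f]) (simp_all add: Q_def N_def)
  qed
  define \<mu> where "\<mu> = Q g"
  have N_0: "h v = 0" if "N h = 0" "v \<in> V" for h v
    using that V by (simp add: N_def sum_nonneg_eq_0_iff)
  have N_nonneg: "0 \<le> N h" for h
    by (simp add: N_def sum_nonneg)
  \<comment> \<open>Both sides are homogeneous of degree two, so the maximum on the sphere controls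
    every function with sum zero.\<close>
  have rayleigh: "Q h \<le> \<mu> * N h" if h: "(\<Sum>v\<in>V. h v) = 0" for h
  proof (cases "N h = 0")
    case True
    then have "Q h = 0"
      using N_0[OF True] by (simp add: Q_def)
    then show ?thesis
      using True by simp
  next
    case False
    define c where "c = sqrt (N h)"
    have c: "c\<^sup>2 = N h" "c \<noteq> 0"
      using N_nonneg False by (simp_all add: c_def)
    have "Q (\<lambda>v. h v / c) \<le> \<mu>"
      unfolding \<mu>_def
      by (rule max) (use h c False in \<open>simp_all add: N_def power_divide sum_divide_distrib[symmetric]\<close>)
    moreover have "Q (\<lambda>v. h v / c) = Q h / N h"
      by (simp add: Q_def sum_divide_distrib c(1)[symmetric] power2_eq_square)
    ultimately show ?thesis
      using False N_nonneg[of h] by (simp add: divide_le_eq)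
  qed
  define Ag where "Ag v = (\<Sum>u\<in>V. a v u * g u)" for v
  \<comment> \<open>\<open>w\<close> is again orthogonal to the constants, and the maximality of \<open>g\<close> along the line
    \<open>g + t w\<close> forces \<open>w = 0\<close>.\<close>
  define w where "w v = \<mu> * g v - Ag v" for v
  have "(\<Sum>v\<in>V. Ag v) = (\<Sum>u\<in>V. (\<Sum>v\<in>V. a u v) * g u)"
    unfolding Ag_def sum_distrib_right by (subst sum.swap) (simp add: sym)
  also have "\<dots> = d * (\<Sum>u\<in>V. g u)"
    by (simp add: reg sum_distrib_left)
  finally have w: "(\<Sum>v\<in>V. w v) = 0"
    using g by (simp add: w_def sum_subtractf sum_distrib_left[symmetric])
  have Q_line: "Q (\<lambda>v. g v + t * w v) = \<mu> + 2 * t * (\<Sum>v\<in>V. w v * Ag v) + t\<^sup>2 * Q w" for t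
  proof -
    have "(\<Sum>v\<in>V. \<Sum>u\<in>V. a v u * g v * w u) = (\<Sum>v\<in>V. w v * Ag v)"
      unfolding Ag_def sum_distrib_left by (subst sum.swap) (simp add: sym ac_simps)
    moreover have "(\<Sum>v\<in>V. \<Sum>u\<in>V. a v u * w v * g u) = (\<Sum>v\<in>V. w v * Ag v)"
      by (simp add: Ag_def sum_distrib_left ac_simps)
    moreover have "Q (\<lambda>v. g v + t * w v) = Q g + t * (\<Sum>v\<in>V. \<Sum>u\<in>V. a v u * g v * w u)
        + t * (\<Sum>v\<in>V. \<Sum>u\<in>V. a v u * w v * g u) + t\<^sup>2 * Q w"
      by (simp add: Q_def sum_distrib_left sum.distrib[symmetric] algebra_simps power2_eq_square)
    ultimately show ?thesis
      by (simp add: \<mu>_def)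
  qed
  have N_line: "N (\<lambda>v. g v + t * w v) = 1 + 2 * t * (\<Sum>v\<in>V. w v * g v) + t\<^sup>2 * N w" for t
  proof -
    have "N (\<lambda>v. g v + t * w v) = N g + 2 * t * (\<Sum>v\<in>V. w v * g v) + t\<^sup>2 * N w"
      by (simp add: N_def sum_distrib_left sum.distrib[symmetric] algebra_simps power2_eq_square)
    then show ?thesis
      using g by simp
  qed
  \<comment> \<open>The choice of \<open>w\<close> as \<open>\<mu> * g - Ag\<close> makes the linear
    term of \<open>\<mu> * N - Q\<close> along the line equal to \<open>2 * t * N w\<close>.\<close>
  have N_w: "N w = \<mu> * (\<Sum>v\<in>V. w v * g v) - (\<Sum>v\<in>V. w v * Ag v)"
    by (simp add: N_def sum_distrib_left sum_subtractf[symmetric] power2_eq_square)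
      (simp add: w_def algebra_simps)
  define c where "c = \<mu> * N w - Q w"
  have c: "0 \<le> c"
    using rayleigh[OF w] by (simp add: c_def)
  have line: "0 \<le> 2 * t * N w + t\<^sup>2 * c" for t
  proof -
    have "Q (\<lambda>v. g v + t * w v) \<le> \<mu> * N (\<lambda>v. g v + t * w v)"
      by (rule rayleigh) (use g w in \<open>simp add: sum.distrib sum_distrib_left[symmetric]\<close>)
    then show ?thesis
      unfolding Q_line N_line c_def N_w by (simp add: algebra_simps)
  qed
  have "N w = 0"
  proof (rule ccontr)
    assume "N w \<noteq> 0"
    then have pos: "0 < N w"
      using N_nonneg[of w] by simp
    \<comment> \<open>At \<open>t = - s\<close> the negative linear term must outweigh the quadratic
      one, which holds once \<open>s * c \<le> N w\<close>. The summand 1 keeps the denominator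
      positive when \<open>c = 0\<close>.\<close>
    define s where "s = N w / (c + 1)"
    have s: "0 < s" "s * c \<le> N w"
      using pos c by (simp_all add: s_def field_simps)
    have "0 \<le> 2 * (- s) * N w + (- s)\<^sup>2 * c"
      by (rule line)
    also have "\<dots> = s * (s * c - 2 * N w)"
      by (simp add: algebra_simps power2_eq_square)
    also have "\<dots> < 0"
      using s pos by (intro mult_pos_neg) auto
    finally show False
      by simp
  qed
  then have eig: "(\<Sum>u\<in>V. a v u * g u) = \<mu> * g v" if "v \<in> V" for v
    using N_0[of w v] that by (simp add: w_def Ag_def)
  \<comment> \<open>A product \<open>g v * g u\<close> is at most the mean of the two squares.
    Nonnegative weights preserve this, and by symmetry and regularity both resulting double sums
    equal \<open>d * N g\<close>.\<close>
  have "\<mu> \<le> (\<Sum>v\<in>V. \<Sum>u\<in>V. a v u * (((g v)\<^sup>2 + (g u)\<^sup>2) / 2))"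
    unfolding \<mu>_def Q_def mult.assoc
    using sum_squares_bound[of "g _" "g _"]
    by (intro sum_mono mult_left_mono nonneg) (simp add: field_simps)
  also have "\<dots> = ((\<Sum>v\<in>V. \<Sum>u\<in>V. a v u * (g v)\<^sup>2) + (\<Sum>v\<in>V. \<Sum>u\<in>V. a v u * (g u)\<^sup>2)) / 2"
    by (simp add: sum.distrib[symmetric] sum_divide_distrib algebra_simps add_divide_distrib)
  also have "(\<Sum>v\<in>V. \<Sum>u\<in>V. a v u * (g u)\<^sup>2) = (\<Sum>v\<in>V. \<Sum>u\<in>V. a v u * (g v)\<^sup>2)"
    by (subst sum.swap) (simp add: sym)
  also have "(\<Sum>v\<in>V. \<Sum>u\<in>V. a v u * (g v)\<^sup>2) = d * N g"
    by (simp add: sum_distrib_right[symmetric] reg N_def sum_distrib_left)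
  finally have "\<mu> \<le> d"
    using g by simp
  with g eig rayleigh[OF x(1)] show thesis
    by (intro that[of \<mu> g]) (auto simp: N_def Q_def)
qed

section \<open>Regular graphs\<close>

text \<open>The enumeration is the one inside \<open>adjacency_matrix\<close>, so matrix equations
  turn into statements about functions on the vertices.\<close>

definition vertex_vec :: "'a ugraph \<Rightarrow> ('a \<Rightarrow> real) \<Rightarrow> real vec" where
  "vertex_vec G f = vec (card (verts G)) (\<lambda>i. f (from_nat_into (verts G) i))"

lemma vertex_vec_carrier: "vertex_vec G f \<in> carrier_vec (card (verts G))"
  by (simp add: vertex_vec_def)

lemma adjacency_matrix_carrier: "adjacency_matrix G \<in> carrier_mat (card (verts G)) (card (verts G))"
  by (simp add: adjacency_matrix_def)

lemma adjacency_matrix_mult_vertex_vec: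
  assumes "finite (verts G)"
  shows "adjacency_matrix G *\<^sub>v vertex_vec G f = vertex_vec G (\<lambda>v. \<Sum>u\<in>neighbours G v. f u)"
proof (rule eq_vecI)
  let ?e = "from_nat_into (verts G)"
  fix i assume "i < dim_vec (vertex_vec G (\<lambda>v. \<Sum>u\<in>neighbours G v. f u))"
  then have i: "i < card (verts G)"
    by (simp add: vertex_vec_def)
  have "(adjacency_matrix G *\<^sub>v vertex_vec G f) $ i
      = (\<Sum>j<card (verts G). if {?e i, ?e j} \<in> edges G then f (?e j) else 0)"
    using i by (auto simp: adjacency_matrix_def vertex_vec_def scalar_prod_def atLeast0LessThan
        intro!: sum.cong)
  also have "\<dots> = (\<Sum>u\<in>verts G. if {?e i, u} \<in> edges G then f u else 0)"
    by (rule sum.reindex_bij_betw[OF bij_betw_from_nat_into_finite[OF assms]])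
  also have "\<dots> = (\<Sum>u\<in>neighbours G (?e i). f u)"
    using assms by (simp add: neighbours_def sum.inter_filter)
  finally show "(adjacency_matrix G *\<^sub>v vertex_vec G f) $ i
      = vertex_vec G (\<lambda>v. \<Sum>u\<in>neighbours G v. f u) $ i"
    using i by (simp add: vertex_vec_def)
qed (simp add: adjacency_matrix_def vertex_vec_def)

text \<open>The index is chosen before \<open>f\<close> varies, so the same coordinate can be read
  off for several functions, as a minor of two vertex vectors requires.\<close>

lemma vertex_vec_index:
  assumes "finite (verts G)" "v \<in> verts G"
  obtains i where "i < card (verts G)" "\<And>f. vertex_vec G f $ i = f v"
  using bij_betw_from_nat_into_finite[OF assms(1)] assms(2)
  by (auto simp: bij_betw_def vertex_vec_def) (metis imageE index_vec lessThan_iff)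

text \<open>Inverting the enumeration makes every vector a vertex vector. Values of \<open>f\<close>
  off the vertex set never enter, since neighbours are vertices.\<close>

lemma graph_eigenvalueE:
  assumes "finite (verts G)" "graph_eigenvalue G \<mu>"
  obtains f v where "v \<in> verts G" "f v \<noteq> 0"
    "\<And>v. v \<in> verts G \<Longrightarrow> (\<Sum>u\<in>neighbours G v. f u) = \<mu> * f v"
proof -
  obtain w where w: "w \<in> carrier_vec (card (verts G))" "w \<noteq> 0\<^sub>v (card (verts G))"
    "adjacency_matrix G *\<^sub>v w = \<mu> \<cdot>\<^sub>v w"
    using assms(2) by (auto simp: graph_eigenvalue_def eigenvalue_def eigenvector_def adjacency_matrix_def)
  define f where "f v = w $ the_inv_into {..<card (verts G)} (from_nat_into (verts G)) v" for v
  have bij: "bij_betw (from_nat_into (verts G)) {..<card (verts G)} (verts G)"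
    by (rule bij_betw_from_nat_into_finite[OF assms(1)])
  have wf: "w = vertex_vec G f"
    using w(1) bij by (intro eq_vecI) (auto simp: vertex_vec_def f_def bij_betw_def the_inv_into_f_f)
  have "\<exists>v\<in>verts G. f v \<noteq> 0"
  proof (rule ccontr)
    assume "\<not> (\<exists>v\<in>verts G. f v \<noteq> 0)"
    then have "vertex_vec G f = 0\<^sub>v (card (verts G))"
      using bij by (intro eq_vecI) (auto simp: vertex_vec_def bij_betw_def)
    then show False
      using w wf by simp
  qed
  moreover have "(\<Sum>u\<in>neighbours G v. f u) = \<mu> * f v" if v: "v \<in> verts G" for v
  proof -
    obtain i where i: "i < card (verts G)" "\<And>f. vertex_vec G f $ i = f v"
      using vertex_vec_index[OF assms(1) v] by blast
    have "vertex_vec G (\<lambda>v. \<Sum>u\<in>neighbours G v. f u) $ i = (\<mu> \<cdot>\<^sub>v vertex_vec G f) $ i"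
      using w(3) unfolding wf adjacency_matrix_mult_vertex_vec[OF assms(1)] by simp
    then show ?thesis
      using i vertex_vec_carrier[of G f] by simp
  qed
  ultimately show thesis
    using that by blast
qed

text \<open>The constants and the maximizer orthogonal to them contribute the roots \<open>d\<close>
  and \<open>\<mu>\<close> with \<open>\<mu> \<le> d\<close>, so the second largest root is at least
  \<open>\<mu>\<close>.\<close>

lemma lambda2_regular_ge:
  assumes V: "finite (verts G)" and reg: "\<And>v. v \<in> verts G \<Longrightarrow> card (neighbours G v) = d"
    and f: "(\<Sum>v\<in>verts G. f v) = 0"
  shows "(\<Sum>v\<in>verts G. \<Sum>u\<in>neighbours G v. f v * f u) \<le> lambda2 G * (\<Sum>v\<in>verts G. (f v)\<^sup>2)"
proof (cases "(\<Sum>v\<in>verts G. (f v)\<^sup>2) = 0")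
  \<comment> \<open>This case absorbs graphs with fewer than two vertices, where
    \<open>lambda2\<close> is an arbitrary value: sum zero forces \<open>f\<close> to vanish there,
    and both sides are 0.\<close>
  case True
  then have "f v = 0" if "v \<in> verts G" for v
    using V that by (simp add: sum_nonneg_eq_0_iff)
  then show ?thesis
    by simp
next
  case False
  define a where "a v u = (if {v, u} \<in> edges G then 1 else 0 :: real)" for v u
  have a_sum: "(\<Sum>u\<in>verts G. a v u * h u) = (\<Sum>u\<in>neighbours G v. h u)" for v h
    using V by (simp add: a_def neighbours_def sum.inter_filter if_distrib[of "\<lambda>x. x * _"] cong: if_cong)
  obtain \<mu> g where g: "\<mu> \<le> real d" "(\<Sum>v\<in>verts G. g v) = 0" "(\<Sum>v\<in>verts G. (g v)\<^sup>2) = 1"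
    "\<And>v. v \<in> verts G \<Longrightarrow> (\<Sum>u\<in>verts G. a v u * g u) = \<mu> * g v"
    and le: "(\<Sum>v\<in>verts G. \<Sum>u\<in>verts G. a v u * f v * f u) \<le> \<mu> * (\<Sum>v\<in>verts G. (f v)\<^sup>2)"
  proof (rule max_eigenpair_orthogonal_to_constants[OF V _ _ _ f False, of a "real d"])
    show "(\<Sum>u\<in>verts G. a v u) = real d" if "v \<in> verts G" for v
      using a_sum[of v "\<lambda>_. 1"] reg[OF that] by simp
  qed (auto simp: a_def insert_commute)
  obtain v where v: "v \<in> verts G" "g v \<noteq> 0"
    using g(3) by (cases "\<forall>v\<in>verts G. g v = 0") auto
  \<comment> \<open>Two vertices at which \<open>g\<close> differs provide the nonzero minor of the
    constant vector and \<open>g\<close>.\<close>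
  have "\<exists>u\<in>verts G. g u \<noteq> g v"
  proof (rule ccontr)
    assume "\<not> (\<exists>u\<in>verts G. g u \<noteq> g v)"
    then have "\<And>u. u \<in> verts G \<Longrightarrow> g u = g v"
      by blast
    then have "(\<Sum>u\<in>verts G. g u) = card (verts G) * g v"
      by simp
    then show False
      using g(2) v V by auto
  qed
  then obtain u where u: "u \<in> verts G" "g u \<noteq> g v"
    by blast
  obtain i j where ij: "i < card (verts G)" "j < card (verts G)"
    "\<And>h. vertex_vec G h $ i = h u" "\<And>h. vertex_vec G h $ j = h v"
    using vertex_vec_index[OF V] u v by metis
  have scale: "vertex_vec G h' = c \<cdot>\<^sub>v vertex_vec G h"
    if "\<And>v. v \<in> verts G \<Longrightarrow> h' v = c * h v" for c h h'
    using that bij_betw_from_nat_into_finite[OF V]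
    by (intro eq_vecI) (auto simp: vertex_vec_def bij_betw_def)
  have dvd: "[:- real d, 1:] * [:- \<mu>, 1:] dvd char_poly (adjacency_matrix G)"
  proof (rule linear_factors_dvd_char_poly[OF adjacency_matrix_carrier vertex_vec_carrier _
        vertex_vec_carrier _ ij(1,2)])
    show "adjacency_matrix G *\<^sub>v vertex_vec G (\<lambda>_. 1) = real d \<cdot>\<^sub>v vertex_vec G (\<lambda>_. 1)"
      unfolding adjacency_matrix_mult_vertex_vec[OF V] by (rule scale) (simp add: reg)
    show "adjacency_matrix G *\<^sub>v vertex_vec G g = \<mu> \<cdot>\<^sub>v vertex_vec G g"
      unfolding adjacency_matrix_mult_vertex_vec[OF V] by (rule scale) (use g a_sum in simp)
  qed (use ij u in simp)
  moreover have "char_poly (adjacency_matrix G) \<noteq> 0"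
    using degree_monic_char_poly[OF adjacency_matrix_carrier[of G]] by auto
  ultimately have "{#real d, \<mu>#} \<subseteq># proots (char_poly (adjacency_matrix G))"
    by (auto elim!: dvdE simp: proots_mult simp del: mult_pCons_left mult_pCons_right)
  then have "\<mu> \<le> lambda2 G"
    unfolding lambda2_def graph_spectrum_def
    by (rule rev_sorted_list_of_multiset_nth_1_ge) (rule g)
  then have "\<mu> * (\<Sum>v\<in>verts G. (f v)\<^sup>2) \<le> lambda2 G * (\<Sum>v\<in>verts G. (f v)\<^sup>2)"
    by (intro mult_right_mono sum_nonneg) auto
  moreover have "(\<Sum>u\<in>neighbours G v. f v * f u) = (\<Sum>u\<in>verts G. a v u * f v * f u)" for v
    using a_sum[of v "\<lambda>u. f v * f u"] by (simp add: mult.assoc)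
  ultimately show ?thesis
    using le by simp
qed

section \<open>Cayley graphs and group actions\<close>

context group
begin

text \<open>Seen from its end \<open>\<tau> \<otimes> \<delta>\<close>, an edge leads to
  \<open>\<delta>\<close>, which is the translate of that end by \<open>inv \<tau>\<close>. Closure
  under inverses puts this element in \<open>T\<close> again.\<close>

lemma neighbours_cay:
  assumes "T \<subseteq> carrier G" "\<And>\<tau>. \<tau> \<in> T \<Longrightarrow> inv \<tau> \<in> T" "\<gamma> \<in> carrier G"
  shows "neighbours (cay G T) \<gamma> = (\<lambda>\<tau>. \<tau> \<otimes> \<gamma>) ` T"
proof (intro equalityI subsetI)
  fix u assume "u \<in> neighbours (cay G T) \<gamma>"
  then obtain \<delta> \<tau> where u: "u \<in> carrier G" "\<delta> \<in> carrier G" "\<tau> \<in> T"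
    "\<gamma> = \<delta> \<and> u = \<tau> \<otimes> \<delta> \<or> \<gamma> = \<tau> \<otimes> \<delta> \<and> u = \<delta>"
    by (auto simp: neighbours_def cay_def doubleton_eq_iff)
  then have "u = \<tau> \<otimes> \<gamma> \<or> u = inv \<tau> \<otimes> \<gamma>"
    using assms(1) by (auto simp: m_assoc[symmetric])
  then show "u \<in> (\<lambda>\<tau>. \<tau> \<otimes> \<gamma>) ` T"
    using assms(2) u(3) by blast
qed (use assms in \<open>auto simp: neighbours_def cay_def\<close>)

lemma sum_neighbours_cay:
  assumes "T \<subseteq> carrier G" "\<And>\<tau>. \<tau> \<in> T \<Longrightarrow> inv \<tau> \<in> T" "\<gamma> \<in> carrier G"
  shows "(\<Sum>u\<in>neighbours (cay G T) \<gamma>. f u) = (\<Sum>\<tau>\<in>T. f (\<tau> \<otimes> \<gamma>))"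
proof -
  have "inj_on (\<lambda>\<tau>. \<tau> \<otimes> \<gamma>) T"
    using assms by (intro inj_on_g)
  then show ?thesis
    by (simp add: neighbours_cay[OF assms] sum.reindex)
qed

text \<open>The Cayley graph is regular of degree \<open>card T\<close>. The group is arbitrary
  because the bound is needed both for the whole group and for a stabilizer as a group of its
  own.\<close>

lemma cay_lambda2_ge:
  assumes "finite (carrier G)" "T \<subseteq> carrier G" "\<And>\<tau>. \<tau> \<in> T \<Longrightarrow> inv \<tau> \<in> T"
    and "(\<Sum>\<gamma>\<in>carrier G. f \<gamma>) = 0"
  shows "(\<Sum>\<gamma>\<in>carrier G. \<Sum>\<tau>\<in>T. f \<gamma> * f (\<tau> \<otimes> \<gamma>))
    \<le> lambda2 (cay G T) * (\<Sum>\<gamma>\<in>carrier G. (f \<gamma>)\<^sup>2)"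
proof -
  have verts: "verts (cay G T) = carrier G"
    by (simp add: cay_def)
  have "card (neighbours (cay G T) \<gamma>) = card T" if "\<gamma> \<in> carrier G" for \<gamma>
    using sum_neighbours_cay[OF assms(2,3) that, of "\<lambda>_. 1::nat"] by simp
  from lambda2_regular_ge[of "cay G T", unfolded verts, OF assms(1) this assms(4)]
  show ?thesis
    by (simp add: sum_neighbours_cay[OF assms(2,3)] cong: sum.cong)
qed

end

section \<open>Transporters as cosets of point stabilizers\<close>

context right_group_action
begin

abbreviation Tr :: "'x \<Rightarrow> 'x \<Rightarrow> 'g set" where
  "Tr \<equiv> transporter \<Gamma> act"

lemma act_inv [simp]: "x \<in> X \<Longrightarrow> \<gamma> \<in> carrier \<Gamma> \<Longrightarrow> act (act x \<gamma>) (inv \<gamma>) = x"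
  by (simp add: act_mult[symmetric] act_one)

lemma act_inv' [simp]: "x \<in> X \<Longrightarrow> \<gamma> \<in> carrier \<Gamma> \<Longrightarrow> act (act x (inv \<gamma>)) \<gamma> = x"
  by (simp add: act_mult[symmetric] act_one)

lemma act_inj: "act x \<gamma> = act y \<gamma> \<Longrightarrow> x \<in> X \<Longrightarrow> y \<in> X \<Longrightarrow> \<gamma> \<in> carrier \<Gamma> \<Longrightarrow> x = y"
  by (metis act_inv)

lemma mem_transporter: "\<gamma> \<in> Tr j i \<longleftrightarrow> \<gamma> \<in> carrier \<Gamma> \<and> act j \<gamma> = i"
  by (simp add: transporter_def)

lemma transporter_subset: "Tr j i \<subseteq> carrier \<Gamma>"
  by (auto simp: mem_transporter)

lemma point_stabilizer_eq: "point_stabilizer \<Gamma> act k = Tr k k"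
  by (simp add: point_stabilizer_def transporter_def)

lemma inv_mem_transporter:
  assumes "t \<in> X" "s \<in> X" "\<tau> \<in> carrier \<Gamma>"
  shows "inv \<tau> \<in> Tr s t \<longleftrightarrow> \<tau> \<in> Tr t s"
  using assms act_inv act_inv' by (auto simp: mem_transporter)

text \<open>Cancelling the action of \<gamma> removes \<open>i\<close> from the condition. This is
  the source of equitability and of the independence of the quotient matrix from
  \<open>i\<close>.\<close>

lemma mult_mem_transporter:
  assumes "s \<in> X" "t \<in> X" "\<tau> \<in> carrier \<Gamma>" "\<gamma> \<in> Tr s i"
  shows "\<tau> \<otimes> \<gamma> \<in> Tr t i \<longleftrightarrow> \<tau> \<in> Tr t s"
proof -
  have "act (act t \<tau>) \<gamma> = act s \<gamma> \<longleftrightarrow> act t \<tau> = s"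
    using assms act_closed by (auto simp: mem_transporter dest: act_inj)
  then show ?thesis
    using assms by (auto simp: mem_transporter act_mult)
qed

lemma bij_betw_transporter_l_mult:
  assumes "t \<in> X" "s \<in> X" "i \<in> X" "\<tau> \<in> Tr t s"
  shows "bij_betw (\<lambda>\<gamma>. \<tau> \<otimes> \<gamma>) (Tr s i) (Tr t i)"
proof (rule bij_betw_byWitness[where f' = "\<lambda>\<delta>. inv \<tau> \<otimes> \<delta>"])
  have \<tau>: "\<tau> \<in> carrier \<Gamma>"
    using assms(4) by (simp add: mem_transporter)
  have inv_\<tau>: "inv \<tau> \<in> Tr s t"
    using assms \<tau> by (simp add: inv_mem_transporter)
  show "(\<otimes>) \<tau> ` Tr s i \<subseteq> Tr t i"
    using assms \<tau> mult_mem_transporter[of s t \<tau> _ i] by auto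
  show "(\<otimes>) (inv \<tau>) ` Tr t i \<subseteq> Tr s i"
    using assms \<tau> inv_\<tau> mult_mem_transporter[of t s "inv \<tau>" _ i] by auto
qed (use assms in \<open>auto simp: mem_transporter m_assoc[symmetric]\<close>)

lemma subgroup_point_stabilizer:
  assumes "k \<in> X"
  shows "subgroup (Tr k k) \<Gamma>"
proof (rule subgroupI)
  have "\<one> \<in> Tr k k"
    using assms by (simp add: mem_transporter act_one)
  then show "Tr k k \<noteq> {}"
    by blast
  show "inv \<gamma> \<in> Tr k k" if "\<gamma> \<in> Tr k k" for \<gamma>
    using that assms inv_mem_transporter transporter_subset by blast
qed (use assms in \<open>auto simp: mem_transporter act_mult\<close>)

lemma transporter_eq_l_coset:
  assumes "i \<in> X" "j \<in> X" "\<gamma> \<in> Tr j i"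
  shows "\<gamma> <#\<^bsub>\<Gamma>\<^esub> Tr i i = Tr j i"
  using bij_betw_imp_surj_on[OF bij_betw_transporter_l_mult[of j i i \<gamma>]] assms
  by (auto simp: l_coset_def)

text \<open>Right multiplication commutes with the left multiplications that define edges, so it
  transports the Cayley graph of the stabilizer to the coset \<open>Tr k i\<close>.\<close>

lemma bij_betw_transporter_r_mult:
  assumes "k \<in> X" "i \<in> X" "g \<in> Tr k i"
  shows "bij_betw (\<lambda>\<gamma>. \<gamma> \<otimes> g) (Tr k k) (Tr k i)"
  by (rule bij_betw_byWitness[where f' = "\<lambda>\<delta>. \<delta> \<otimes> inv g"])
    (use assms act_inv[of k g] in \<open>auto simp: mem_transporter m_assoc act_mult simp del: act_inv\<close>)

lemma partition_by_preimage:
  assumes "i \<in> X" 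
  shows "(\<Union>j\<in>X. Tr j i) = carrier \<Gamma>" "disjoint_family_on (\<lambda>j. Tr j i) X"
proof -
  have "\<gamma> \<in> Tr (act i (inv \<gamma>)) i" "act i (inv \<gamma>) \<in> X" if "\<gamma> \<in> carrier \<Gamma>" for \<gamma>
    using that assms act_closed by (auto simp: mem_transporter)
  then show "(\<Union>j\<in>X. Tr j i) = carrier \<Gamma>"
    using transporter_subset by blast
  show "disjoint_family_on (\<lambda>j. Tr j i) X"
    by (auto simp: disjoint_family_on_def mem_transporter dest: act_inj)
qed

text \<open>Fixing the source instead of the target gives the right cosets of the stabilizer of
  \<open>k\<close>, over which the quadratic form is split later.\<close>

lemma partition_by_image:
  assumes "k \<in> X"
  shows "(\<Union>i\<in>X. Tr k i) = carrier \<Gamma>" "disjoint_family_on (\<lambda>i. Tr k i) X"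
  using act_closed[OF assms] by (auto simp: disjoint_family_on_def mem_transporter)

lemma card_neighbours_transporter:
  assumes T: "T \<subseteq> carrier \<Gamma>" "\<And>\<tau>. \<tau> \<in> T \<Longrightarrow> inv \<tau> \<in> T"
    and X: "s \<in> X" "t \<in> X" and v: "v \<in> Tr s i"
  shows "card (neighbours (cay \<Gamma> T) v \<inter> Tr t i) = card (T \<inter> Tr t s)"
proof -
  have vc: "v \<in> carrier \<Gamma>"
    using v by (simp add: mem_transporter)
  have "neighbours (cay \<Gamma> T) v \<inter> Tr t i = (\<lambda>\<tau>. \<tau> \<otimes> v) ` (T \<inter> Tr t s)"
    using mult_mem_transporter[OF X _ v] T by (auto simp: neighbours_cay[OF T vc])
  moreover have "inj_on (\<lambda>\<tau>. \<tau> \<otimes> v) (T \<inter> Tr t s)"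
    using T vc by (intro inj_on_g) auto
  ultimately show ?thesis
    by (simp add: card_image)
qed

lemma card_inter_transporter_sym:
  assumes T: "T \<subseteq> carrier \<Gamma>" "\<And>\<tau>. \<tau> \<in> T \<Longrightarrow> inv \<tau> \<in> T" and X: "s \<in> X" "t \<in> X"
  shows "card (T \<inter> Tr t s) = card (T \<inter> Tr s t)"
proof (rule bij_betw_same_card)
  show "bij_betw (\<lambda>\<tau>. inv \<tau>) (T \<inter> Tr t s) (T \<inter> Tr s t)"
    by (rule bij_betw_byWitness[where f' = "\<lambda>\<tau>. inv \<tau>"]) (use T inv_mem_transporter X in auto)
qed

text \<open>Each \<tau> moves exactly one point \<open>t\<close> to \<open>s\<close>, so left
  multiplication by \<tau> carries \<open>Tr s i\<close> onto the single cell \<open>Tr t i\<close>.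
  Grouping \<open>T\<close> by this point produces the entries of the quotient matrix as
  coefficients.\<close>

lemma sum_transporter_cay:
  fixes f :: "'g \<Rightarrow> real"
  assumes T: "finite T" "T \<subseteq> carrier \<Gamma>" and X: "finite X" "s \<in> X" "i \<in> X"
  shows "(\<Sum>\<gamma>\<in>Tr s i. \<Sum>\<tau>\<in>T. f (\<tau> \<otimes> \<gamma>)) = (\<Sum>t\<in>X. real (card (T \<inter> Tr t s)) * (\<Sum>\<gamma>\<in>Tr t i. f \<gamma>))"
proof -
  have "(\<Sum>\<gamma>\<in>Tr s i. f (\<tau> \<otimes> \<gamma>)) = (\<Sum>t\<in>X. if \<tau> \<in> Tr t s then \<Sum>\<gamma>\<in>Tr t i. f \<gamma> else 0)"
    if "\<tau> \<in> T" for \<tau>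
  proof -
    define t where "t = act s (inv \<tau>)"
    have \<tau>: "\<tau> \<in> carrier \<Gamma>"
      using that T by auto
    have t: "t \<in> X" "\<tau> \<in> Tr t s"
      using X \<tau> act_closed by (auto simp: t_def mem_transporter)
    have "\<tau> \<in> Tr t' s \<longleftrightarrow> t' = t" if "t' \<in> X" for t'
      using that t act_inj[of t' \<tau> t] \<tau> by (auto simp: mem_transporter)
    then have "(\<Sum>t'\<in>X. if \<tau> \<in> Tr t' s then \<Sum>\<gamma>\<in>Tr t' i. f \<gamma> else 0)
        = (\<Sum>t'\<in>X. if t' = t then \<Sum>\<gamma>\<in>Tr t' i. f \<gamma> else 0)"
      by (simp cong: sum.cong)
    also have "\<dots> = (\<Sum>\<gamma>\<in>Tr t i. f \<gamma>)"
      using X t by simp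
    also have "\<dots> = (\<Sum>\<gamma>\<in>Tr s i. f (\<tau> \<otimes> \<gamma>))"
      by (rule sum.reindex_bij_betw[symmetric, OF bij_betw_transporter_l_mult]) (use X t in auto)
    finally show ?thesis
      by simp
  qed
  then have "(\<Sum>\<tau>\<in>T. \<Sum>\<gamma>\<in>Tr s i. f (\<tau> \<otimes> \<gamma>))
      = (\<Sum>t\<in>X. \<Sum>\<tau>\<in>T. if \<tau> \<in> Tr t s then \<Sum>\<gamma>\<in>Tr t i. f \<gamma> else 0)"
    by (subst sum.swap) simp
  also have "\<dots> = (\<Sum>t\<in>X. real (card (T \<inter> Tr t s)) * (\<Sum>\<gamma>\<in>Tr t i. f \<gamma>))"
    using T(1) by (simp add: sum.inter_restrict[symmetric])
  finally show ?thesis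
    by (subst sum.swap)
qed

end

section \<open>Transitive actions and the splitting of the quadratic form\<close>

context transitive_right_group_action
begin

lemma transporter_nonempty: "j \<in> X \<Longrightarrow> i \<in> X \<Longrightarrow> Tr j i \<noteq> {}"
  using transitive[of j i] mem_transporter by blast

lemma transporters_eq_lcosets:
  assumes "i \<in> X"
  shows "(\<lambda>j. Tr j i) ` X = lcosets\<^bsub>\<Gamma>\<^esub> (Tr i i)"
proof (intro equalityI subsetI)
  fix A assume "A \<in> (\<lambda>j. Tr j i) ` X"
  then obtain j \<gamma> where "j \<in> X" "A = Tr j i" "\<gamma> \<in> Tr j i"
    using transporter_nonempty assms by fast
  then show "A \<in> lcosets\<^bsub>\<Gamma>\<^esub> (Tr i i)"
    using transporter_eq_l_coset[OF assms] transporter_subset by (fastforce simp: LCOSETS_def)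
next
  fix A assume "A \<in> lcosets\<^bsub>\<Gamma>\<^esub> (Tr i i)"
  then obtain \<gamma> where \<gamma>: "\<gamma> \<in> carrier \<Gamma>" "A = \<gamma> <#\<^bsub>\<Gamma>\<^esub> Tr i i"
    by (auto simp: LCOSETS_def)
  have "act i (inv \<gamma>) \<in> X" "\<gamma> \<in> Tr (act i (inv \<gamma>)) i"
    using \<gamma> assms act_closed by (auto simp: mem_transporter)
  then show "A \<in> (\<lambda>j. Tr j i) ` X"
    using \<gamma> transporter_eq_l_coset[OF assms] by blast
qed

text \<open>Left multiplication by an element fixing \<open>k\<close> preserves every
  \<open>Tr k i\<close>, so that part of the form is bounded coset by coset. The other elements of
  \<open>T\<close> are treated on the whole group, where \<open>f\<close> has sum zero because its
  coset sums vanish.\<close>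

lemma lambda2_sum_ge:
  fixes f :: "'a \<Rightarrow> real"
  assumes fin: "finite (carrier \<Gamma>)" "finite X"
    and T: "T \<subseteq> carrier \<Gamma>" "\<And>\<tau>. \<tau> \<in> T \<Longrightarrow> inv \<tau> \<in> T" and k: "k \<in> X"
    and f: "\<And>i. i \<in> X \<Longrightarrow> (\<Sum>\<gamma>\<in>Tr k i. f \<gamma>) = 0"
  shows "(\<Sum>\<gamma>\<in>carrier \<Gamma>. \<Sum>\<tau>\<in>T. f \<gamma> * f (\<tau> \<otimes> \<gamma>))
    \<le> (lambda2 (cay (\<Gamma>\<lparr>carrier := Tr k k\<rparr>) (T \<inter> Tr k k)) + lambda2 (cay \<Gamma> (T - T \<inter> Tr k k)))
      * (\<Sum>\<gamma>\<in>carrier \<Gamma>. (f \<gamma>)\<^sup>2)"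
proof -
  have finite_Tr: "finite (Tr k i)" for i
    using fin transporter_subset finite_subset by blast
  have sum_carrier: "(\<Sum>\<gamma>\<in>carrier \<Gamma>. h \<gamma>) = (\<Sum>i\<in>X. \<Sum>\<gamma>\<in>Tr k i. h \<gamma>)" for h :: "'a \<Rightarrow> real"
    using sum.UNION_disjoint_family[OF fin(2) _ partition_by_image(2)[OF k], of h]
    by (simp add: finite_Tr partition_by_image(1)[OF k])
  interpret S: group "\<Gamma>\<lparr>carrier := Tr k k\<rparr>"
    by (rule subgroup.subgroup_is_group[OF subgroup_point_stabilizer[OF k] is_group])
  let ?l = "lambda2 (cay (\<Gamma>\<lparr>carrier := Tr k k\<rparr>) (T \<inter> Tr k k))"
  have inv_S: "inv\<^bsub>\<Gamma>\<lparr>carrier := Tr k k\<rparr>\<^esub> \<tau> \<in> T \<inter> Tr k k" if "\<tau> \<in> T \<inter> Tr k k" for \<tau>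
    using that T k inv_mem_transporter[of k k \<tau>]
    by (auto simp: m_inv_consistent[OF subgroup_point_stabilizer[OF k]])
  have coset: "(\<Sum>\<gamma>\<in>Tr k i. \<Sum>\<tau>\<in>T \<inter> Tr k k. f \<gamma> * f (\<tau> \<otimes> \<gamma>)) \<le> ?l * (\<Sum>\<gamma>\<in>Tr k i. (f \<gamma>)\<^sup>2)"
    if i: "i \<in> X" for i
  proof -
    \<comment> \<open>Right translation by any \<open>g\<close> moving \<open>k\<close> to
      \<open>i\<close> pulls \<open>f\<close> back to a function on the stabilizer that still sums
      to zero.\<close>
    obtain g where g: "g \<in> Tr k i"
      using transporter_nonempty k i by blast
    have reindex: "(\<Sum>\<gamma>\<in>Tr k i. h \<gamma>) = (\<Sum>\<gamma>\<in>Tr k k. h (\<gamma> \<otimes> g))" for h :: "'a \<Rightarrow> real"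
      by (rule sum.reindex_bij_betw[symmetric, OF bij_betw_transporter_r_mult[OF k i g]])
    have "(\<Sum>\<gamma>\<in>Tr k i. \<Sum>\<tau>\<in>T \<inter> Tr k k. f \<gamma> * f (\<tau> \<otimes> \<gamma>))
        = (\<Sum>\<gamma>\<in>Tr k k. \<Sum>\<tau>\<in>T \<inter> Tr k k. f (\<gamma> \<otimes> g) * f (\<tau> \<otimes> \<gamma> \<otimes> g))"
      unfolding reindex by (intro sum.cong refl) (use g in \<open>auto simp: mem_transporter m_assoc\<close>)
    also have "\<dots> \<le> ?l * (\<Sum>\<gamma>\<in>Tr k i. (f \<gamma>)\<^sup>2)"
      using S.cay_lambda2_ge[OF _ _ inv_S, of "\<lambda>\<gamma>. f (\<gamma> \<otimes> g)"] f[OF i] finite_Tr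
      by (simp add: reindex)
    finally show ?thesis .
  qed
  have "(\<Sum>\<gamma>\<in>carrier \<Gamma>. \<Sum>\<tau>\<in>T \<inter> Tr k k. f \<gamma> * f (\<tau> \<otimes> \<gamma>)) \<le> ?l * (\<Sum>\<gamma>\<in>carrier \<Gamma>. (f \<gamma>)\<^sup>2)"
    unfolding sum_carrier sum_distrib_left[of ?l _ X] by (rule sum_mono) (rule coset)
  moreover have "(\<Sum>\<gamma>\<in>carrier \<Gamma>. \<Sum>\<tau>\<in>T - T \<inter> Tr k k. f \<gamma> * f (\<tau> \<otimes> \<gamma>))
      \<le> lambda2 (cay \<Gamma> (T - T \<inter> Tr k k)) * (\<Sum>\<gamma>\<in>carrier \<Gamma>. (f \<gamma>)\<^sup>2)"
  proof (rule cay_lambda2_ge[OF fin(1)])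
    show "inv \<tau> \<in> T - T \<inter> Tr k k" if "\<tau> \<in> T - T \<inter> Tr k k" for \<tau>
      using that T inv_mem_transporter[OF k k] by blast
    show "(\<Sum>\<gamma>\<in>carrier \<Gamma>. f \<gamma>) = 0"
      unfolding sum_carrier using f by simp
  qed (use T in auto)
  moreover have "(\<Sum>\<tau>\<in>T. h \<tau>) = (\<Sum>\<tau>\<in>T \<inter> Tr k k. h \<tau>) + (\<Sum>\<tau>\<in>T - T \<inter> Tr k k. h \<tau>)" for h :: "'a \<Rightarrow> real"
    using sum.subset_diff[of "T \<inter> Tr k k" T h] finite_subset[OF T(1) fin(1)] by simp
  ultimately show ?thesis
    by (simp add: sum.distrib distrib_right)
qed

end

theorem theorem2p6:
  fixes \<Gamma> :: "('g, 'm) monoid_scheme" and act :: "nat \<Rightarrow> 'g \<Rightarrow> nat" and T :: "'g set" and n :: nat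
  assumes "transitive_right_group_action \<Gamma> {1..n} act"
    and "finite (carrier \<Gamma>)"
    and "T \<subseteq> carrier \<Gamma>"
    and "\<one>\<^bsub>\<Gamma>\<^esub> \<notin> T"
    and "T = set_inv\<^bsub>\<Gamma>\<^esub> T"
  shows "(\<forall>i \<in> {1..n}.
            (\<lambda>j. transporter \<Gamma> act j i) ` {1..n} = lcosets\<^bsub>\<Gamma>\<^esub> (point_stabilizer \<Gamma> act i) \<and>
            equitable_partition (cay \<Gamma> T) n (\<lambda>j. transporter \<Gamma> act j i) \<and>
            quotient_matrix (cay \<Gamma> T) n (\<lambda>j. transporter \<Gamma> act j i) = B_mat \<Gamma> act T n) \<and>
         transpose_mat (B_mat \<Gamma> act T n) = B_mat \<Gamma> act T n \<and>
         (\<forall>\<mu>. graph_eigenvalue (cay \<Gamma> T) \<mu> \<longrightarrow> \<not> eigenvalue (B_mat \<Gamma> act T n) \<mu> \<longrightarrow>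
            (\<forall>k \<in> {1..n}.
               \<mu> \<le> lambda2 (cay (\<Gamma>\<lparr>carrier := point_stabilizer \<Gamma> act k\<rparr>) (T \<inter> point_stabilizer \<Gamma> act k))
                 + lambda2 (cay \<Gamma> (T - (T \<inter> point_stabilizer \<Gamma> act k)))))"
proof -
  interpret transitive_right_group_action \<Gamma> "{1..n}" act
    by (rule assms(1))
  have inv_T: "inv\<^bsub>\<Gamma>\<^esub> \<tau> \<in> T" if "\<tau> \<in> T" for \<tau>
    using that by (subst assms(5)) (auto simp: SET_INV_def)
  note T = assms(3) inv_T
  have fin_T: "finite T"
    using assms finite_subset by blast
  have verts: "verts (cay \<Gamma> T) = carrier \<Gamma>"
    by (simp add: cay_def)

  \<comment> \<open>Equitability and the quotient matrix\<close>
  have "equitable_partition (cay \<Gamma> T) n (\<lambda>j. Tr j i)" if i: "i \<in> {1..n}" for i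
    unfolding equitable_partition_def
  proof (intro conjI)
    show "partition_on (verts (cay \<Gamma> T)) ((\<lambda>j. Tr j i) ` {1..n})"
    proof (rule partition_onI)
      show "\<Union> ((\<lambda>j. Tr j i) ` {1..n}) = verts (cay \<Gamma> T)"
        using partition_by_preimage(1)[OF i] verts by simp
      show "disjnt p q" if pq: "p \<in> (\<lambda>j. Tr j i) ` {1..n}" "q \<in> (\<lambda>j. Tr j i) ` {1..n}" "p \<noteq> q" for p q
      proof -
        obtain j l where "j \<in> {1..n}" "l \<in> {1..n}" "p = Tr j i" "q = Tr l i"
          using pq(1,2) by blast
        moreover have "j \<noteq> l"
          using calculation pq(3) by blast
        ultimately show ?thesis
          using disjoint_family_onD[OF partition_by_preimage(2)[OF i]] by (simp add: disjnt_def)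
      qed
      show "{} \<notin> (\<lambda>j. Tr j i) ` {1..n}"
        using transporter_nonempty[OF _ i] by (metis imageE)
    qed
    show "\<exists>b. \<forall>s\<in>{1..n}. \<forall>t\<in>{1..n}. \<forall>v\<in>Tr s i. card (neighbours (cay \<Gamma> T) v \<inter> Tr t i) = b s t"
      using card_neighbours_transporter[OF T] by (intro exI[of _ "\<lambda>s t. card (T \<inter> Tr t s)"]) blast
  qed (rule partition_by_preimage(2)[OF i])
  moreover have "quotient_matrix (cay \<Gamma> T) n (\<lambda>j. Tr j i) = B_mat \<Gamma> act T n" if i: "i \<in> {1..n}" for i
  proof -
    have "(THE b. \<forall>v\<in>Tr (Suc s) i. card (neighbours (cay \<Gamma> T) v \<inter> Tr (Suc t) i) = b)
        = card (T \<inter> Tr (Suc t) (Suc s))" if "s < n" "t < n" for s t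
    proof -
      have st: "Suc s \<in> {1..n}" "Suc t \<in> {1..n}"
        using that by auto
      \<comment> \<open>The cell is nonempty by transitivity, which makes the described number
        unique.\<close>
      show ?thesis
        using card_neighbours_transporter[OF T st, of _ i] transporter_nonempty[OF st(1) i]
        by (intro the_equality) auto
    qed
    then show ?thesis
      by (intro eq_matI) (auto simp: quotient_matrix_def B_mat_def)
  qed
  moreover have "transpose_mat (B_mat \<Gamma> act T n) = B_mat \<Gamma> act T n"
    using card_inter_transporter_sym[OF T] by (intro eq_matI) (auto simp: B_mat_def)

  \<comment> \<open>The bound for eigenvalues outside the quotient matrix\<close>
  moreover have "\<mu> \<le> lambda2 (cay (\<Gamma>\<lparr>carrier := Tr k k\<rparr>) (T \<inter> Tr k k)) + lambda2 (cay \<Gamma> (T - (T \<inter> Tr k k)))"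
    if \<mu>: "graph_eigenvalue (cay \<Gamma> T) \<mu>" "\<not> eigenvalue (B_mat \<Gamma> act T n) \<mu>" and k: "k \<in> {1..n}" for \<mu> k
  proof -
    obtain f v where f: "v \<in> carrier \<Gamma>" "f v \<noteq> 0"
      "\<And>\<gamma>. \<gamma> \<in> carrier \<Gamma> \<Longrightarrow> (\<Sum>u\<in>neighbours (cay \<Gamma> T) \<gamma>. f u) = \<mu> * f \<gamma>"
      using graph_eigenvalueE[OF _ \<mu>(1)] assms(2) unfolding verts by metis
    have f_eig: "(\<Sum>\<tau>\<in>T. f (\<tau> \<otimes>\<^bsub>\<Gamma>\<^esub> \<gamma>)) = \<mu> * f \<gamma>" if "\<gamma> \<in> carrier \<Gamma>" for \<gamma>
      using f(3)[OF that] sum_neighbours_cay[OF T that, of f] by simp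
    have zero: "(\<Sum>\<gamma>\<in>Tr j i. f \<gamma>) = 0" if i: "i \<in> {1..n}" and j: "j \<in> {1..n}" for i j
    proof -
      \<comment> \<open>The cell sums of \<open>f\<close> satisfy the eigenvector equation of the
        quotient matrix for \<mu>, so they must all vanish. Entry \<open>j\<close> belongs to the
        cell of the point \<open>Suc j\<close>.\<close>
      define w where "w = vec n (\<lambda>j. \<Sum>\<gamma>\<in>Tr (Suc j) i. f \<gamma>)"
      have "B_mat \<Gamma> act T n *\<^sub>v w = \<mu> \<cdot>\<^sub>v w"
      proof (rule eq_vecI)
        fix s assume "s < dim_vec (\<mu> \<cdot>\<^sub>v w)"
        then have s: "s < n" "Suc s \<in> {1..n}"
          by (auto simp: w_def)
        have "(B_mat \<Gamma> act T n *\<^sub>v w) $ s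
            = (\<Sum>t<n. real (card (T \<inter> Tr (Suc t) (Suc s))) * (\<Sum>\<gamma>\<in>Tr (Suc t) i. f \<gamma>))"
          using s by (simp add: B_mat_def w_def scalar_prod_def atLeast0LessThan)
        also have "\<dots> = (\<Sum>t\<in>{1..n}. real (card (T \<inter> Tr t (Suc s))) * (\<Sum>\<gamma>\<in>Tr t i. f \<gamma>))"
          by (rule sum.reindex_bij_betw) (auto simp: bij_betw_def image_Suc_lessThan)
        also have "\<dots> = (\<Sum>\<gamma>\<in>Tr (Suc s) i. \<Sum>\<tau>\<in>T. f (\<tau> \<otimes>\<^bsub>\<Gamma>\<^esub> \<gamma>))"
          using sum_transporter_cay[OF fin_T assms(3) _ s(2) i] by simp
        also have "\<dots> = \<mu> * (\<Sum>\<gamma>\<in>Tr (Suc s) i. f \<gamma>)"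
          unfolding sum_distrib_left by (intro sum.cong refl f_eig) (simp add: mem_transporter)
        finally show "(B_mat \<Gamma> act T n *\<^sub>v w) $ s = (\<mu> \<cdot>\<^sub>v w) $ s"
          using s by (simp add: w_def)
      qed (simp add: B_mat_def w_def)
      moreover have "dim_row (B_mat \<Gamma> act T n) = n" "w \<in> carrier_vec n"
        by (simp_all add: B_mat_def w_def)
      ultimately have "w = 0\<^sub>v n"
        using \<mu>(2) by (auto simp: eigenvalue_def eigenvector_def)
      moreover have "w $ (j - 1) = (\<Sum>\<gamma>\<in>Tr j i. f \<gamma>)" "j - 1 < n"
        using j by (auto simp: w_def)
      ultimately show ?thesis
        by simp
    qed
    \<comment> \<open>For an eigenfunction the quadratic form is exactly \<mu> times the squared
      norm, and this norm is positive because \<open>f v \<noteq> 0\<close>, so it can be cancelled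
      at the end.\<close>
    have "\<mu> * (\<Sum>\<gamma>\<in>carrier \<Gamma>. (f \<gamma>)\<^sup>2) = (\<Sum>\<gamma>\<in>carrier \<Gamma>. \<Sum>\<tau>\<in>T. f \<gamma> * f (\<tau> \<otimes>\<^bsub>\<Gamma>\<^esub> \<gamma>))"
      by (simp add: sum_distrib_left[symmetric] f_eig power2_eq_square)
        (simp add: sum_distrib_left algebra_simps)
    also have "\<dots> \<le> (lambda2 (cay (\<Gamma>\<lparr>carrier := Tr k k\<rparr>) (T \<inter> Tr k k)) + lambda2 (cay \<Gamma> (T - (T \<inter> Tr k k))))
        * (\<Sum>\<gamma>\<in>carrier \<Gamma>. (f \<gamma>)\<^sup>2)"
      using lambda2_sum_ge[OF assms(2) _ T k zero[OF _ k]] by simp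
    finally show ?thesis
      using f(1,2) assms(2) by (simp add: mult_le_cancel_right sum_pos2[of _ v] not_less[symmetric])
  qed
  ultimately show ?thesis
    using transporters_eq_lcosets by (auto simp: point_stabilizer_eq)
qed

end
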